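(* Let $p>1$, let $H=(V,E,W)$ be a connected hypergraph, let $L\subset V$ be a nonempty set of labeled vertices and let $y_i\in\mathbb{R}$ be given labels for $x_i\in L$. Then the problem $$\begin{cases}\displaystyle\sum_{k=1}^m w_k\chi_k(x_i)\Big|\max_{x_j\in e_k}u(x_j)+\min_{x_j\in e_k}u(x_j)-2u(x_i)\Big|^{p-2}\Big(\max_{x_j\in e_k}u(x_j)+\min_{x_j\in e_k}u(x_j)-2u(x_i)\Big)=0,& x_i\in V\setminus L,\\ u(x_i)=y_i,& x_i\in L,\end{cases}$$ admits a unique solution $u:V\to\mathbb{R}$, and this solution satisfies $$\min_{x_j\in L}y_j\le u(x_i)\le\max_{x_j\in L}y_j\quad\text{for all }x_i\in V.$$
   Context: A hypergraph $H=(V,E,W)$ consists of a finite vertex set $V=\{x_i\}_{i=1}^n\subset\mathbb{R}^d$, a finite family of hyperedges $E=\{e_k\}_{k=1}^m$ (nonempty subsets of $V$) and positive weights $W=\{w_k\}_{k=1}^m$. It is connected if for any $x_i,x_j\in V$ there are hyperedges $e_{k_1},\dots,e_{k_l}\in E$ with $x_i\in e_{k_1}$, $x_j\in e_{k_l}$ and $e_{k_s}\cap e_{k_{s+1}}\neq\emptyset$ for $s=1,\dots,l-1$. $\chi_k(x_i)=1$ if $x_i\in e_k$ and $\chi_k(x_i)=0$ otherwise. Convention: $|0|^{p-2}0=0$ (also for $1<p<2$). *)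

theory Defs
  imports "HOL-Analysis.Analysis"
begin

text \<open>
  A hypergraph consists of its vertex set \<open>V\<close> and the indexed families \<open>e 1, \<dots>, e m\<close> of hyperedges
  and \<open>w 1, \<dots>, w m\<close> of weights; the hyperedges form a family, so repetitions are allowed.
  The values of \<open>e\<close> and \<open>w\<close> outside \<open>{1..m}\<close> are irrelevant.
\<close>

definition hypergraph ::
  "(real ^ 'd) set \<Rightarrow> nat \<Rightarrow> (nat \<Rightarrow> (real ^ 'd) set) \<Rightarrow> (nat \<Rightarrow> real) \<Rightarrow> bool" where
  "hypergraph V m e w \<longleftrightarrow>
     finite V \<and> (\<forall>k\<in>{1..m}. e k \<subseteq> V \<and> e k \<noteq> {} \<and> 0 < w k)"

definition hypergraph_connected ::
  "(real ^ 'd) set \<Rightarrow> nat \<Rightarrow> (nat \<Rightarrow> (real ^ 'd) set) \<Rightarrow> bool" where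
  "hypergraph_connected V m e \<longleftrightarrow>
     (\<forall>x\<in>V. \<forall>y\<in>V. \<exists>(l::nat) (\<kappa>::nat \<Rightarrow> nat). 1 \<le> l \<and> (\<forall>s\<in>{1..l}. \<kappa> s \<in> {1..m}) \<and>
        x \<in> e (\<kappa> 1) \<and> y \<in> e (\<kappa> l) \<and>
        (\<forall>s\<in>{1..<l}. e (\<kappa> s) \<inter> e (\<kappa> (s + 1)) \<noteq> {}))"

text \<open>
  The function \<open>t \<mapsto> \<bar>t\<bar>\<^sup>p\<^sup>-\<^sup>2 t\<close>. At \<open>t = 0\<close> it takes the value \<open>0\<close> for every \<open>p\<close>, in
  particular for \<open>1 < p < 2\<close>, because the second factor vanishes.
\<close>

definition signed_power :: "real \<Rightarrow> real \<Rightarrow> real" where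
  "signed_power p t = \<bar>t\<bar> powr (p - 2) * t"

definition hypergraph_operator ::
  "real \<Rightarrow> nat \<Rightarrow> (nat \<Rightarrow> (real ^ 'd) set) \<Rightarrow> (nat \<Rightarrow> real) \<Rightarrow> (real ^ 'd \<Rightarrow> real) \<Rightarrow> real ^ 'd \<Rightarrow> real" where
  "hypergraph_operator p m e w u x =
     (\<Sum>k = 1..m. w k * indicator (e k) x *
        signed_power p (Max (u ` e k) + Min (u ` e k) - 2 * u x))"

text \<open>
  Functions \<open>V \<rightarrow> \<real>\<close> are represented by the extensional function space, so that uniqueness
  of a solution means equality on \<open>V\<close>.
\<close>

definition is_solution ::
  "real \<Rightarrow> (real ^ 'd) set \<Rightarrow> nat \<Rightarrow> (nat \<Rightarrow> (real ^ 'd) set) \<Rightarrow> (nat \<Rightarrow> real) \<Rightarrow>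
   (real ^ 'd) set \<Rightarrow> (real ^ 'd \<Rightarrow> real) \<Rightarrow> (real ^ 'd \<Rightarrow> real) \<Rightarrow> bool" where
  "is_solution p V m e w L y u \<longleftrightarrow>
     u \<in> V \<rightarrow>\<^sub>E (UNIV :: real set) \<and>
     (\<forall>x\<in>V - L. hypergraph_operator p m e w u x = 0) \<and>
     (\<forall>x\<in>L. u x = y x)"

end

theory Submission
  imports Defs
begin

text \<open>
  Write \<open>\<phi> t = \<bar>t\<bar>\<^sup>p\<^sup>-\<^sup>2 t\<close>, a continuous and strictly increasing function for \<open>p > 1\<close>, and let
  \<open>\<Delta> u x\<close> be the left-hand side of the equation at \<open>x\<close>. Since \<open>\<phi>\<close> increases, \<open>\<Delta> u x\<close> is
  nondecreasing in the edge maxima and minima and, as some edge contains \<open>x\<close>, strictly decreasing in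
  the term \<open>u x\<close> that is subtracted from them. In general the operator is not the gradient of an
  energy (a function \<open>u\<close> with \<open>u x\<^sub>1 < u x\<^sub>2 < u x\<^sub>3\<close> on an edge \<open>{x\<^sub>1, x\<^sub>2, x\<^sub>3}\<close> has a term at \<open>x\<^sub>1\<close>
  that does not depend on \<open>u x\<^sub>2\<close>, and a term at \<open>x\<^sub>2\<close> that depends on \<open>u x\<^sub>1\<close>), so everything is
  drawn from this monotonicity: uniqueness and the bounds from a comparison principle,
  existence from an order-theoretic fixed point.

  Comparison (lemma \<open>hypergraph_comparison\<close>): let \<open>\<Delta> u \<ge> 0 \<ge> \<Delta> v\<close> off \<open>L\<close> and \<open>u \<le> v\<close> on \<open>L\<close>, and
  suppose that \<open>M = max (u - v)\<close> is positive. Where \<open>u - v = M\<close>, every edge through the point has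
  \<open>max u = max v + M\<close> and \<open>min u = min v + M\<close>. This alone does not spread the contact set over
  the edge, but it shows that the maximum of \<open>u\<close> on the edge is attained in the contact set. Thus, at
  a contact point where \<open>u\<close> is largest among all contact points, \<open>u\<close> attains its maximum on every
  edge through that point; then all terms of \<open>\<Delta> u\<close> are nonpositive and their sum is not negative, so they vanish, and \<open>u\<close>, hence
  also \<open>v\<close>, is constant on each of these edges. So the set of such contact points contains every
  edge that it meets, and by connectedness it is all of \<open>V\<close>, which contradicts \<open>u \<le> v\<close> on \<open>L\<close>.
  Constants satisfy the equation, which gives the bounds.

  Existence (lemma \<open>hypergraph_solution_exists\<close>): let \<open>T u x\<close> be the number \<open>t\<close> that solves the
  equation at \<open>x\<close> when the edge maxima and minima are those of \<open>u\<close> and only the subtracted value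
  \<open>u x\<close> is replaced by \<open>t\<close>; on \<open>L\<close> put \<open>T u = y\<close>. If \<open>u\<close> takes
  its values between the smallest and the largest label, then \<open>t\<close> exists in the same interval by
  the intermediate value theorem; by strictness it is unique, and it is a nondecreasing function
  of \<open>u\<close>. A fixed point of \<open>T\<close> is a solution, and one exists by the Knaster--Tarski argument.
\<close>

section \<open>The signed power\<close>

text \<open>
  The difference of the powers of the positive and the negative part: in this form continuity
  and monotonicity pass over from \<open>t \<mapsto> t\<^sup>p\<^sup>-\<^sup>1\<close> on the half-line \<open>t \<ge> 0\<close> without a case distinction
  at the singular point \<open>0\<close> of the factor \<open>\<bar>t\<bar>\<^sup>p\<^sup>-\<^sup>2\<close>.
\<close>

lemma signed_power_eq_diff_powr:
  assumes "p > 1"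
  shows "signed_power p t = max 0 t powr (p - 1) - max 0 (- t) powr (p - 1)"
proof -
  have pos: "s powr (p - 2) * s = s powr (p - 1)" if "s > 0" for s :: real
    using that powr_add[of s "p - 2" 1] by simp
  consider "t = 0" | "t > 0" | "t < 0" by linarith
  then show ?thesis
  proof cases
    case 3
    then show ?thesis using pos[of "- t"] by (simp add: signed_power_def)
  qed (use pos[of t] in \<open>simp_all add: signed_power_def\<close>)
qed

lemma signed_power_0 [simp]: "signed_power p 0 = 0"
  by (simp add: signed_power_def)

lemma signed_power_strict_mono:
  assumes "p > 1" and "s < t"
  shows "signed_power p s < signed_power p t"
proof -
  have le: "max 0 s powr (p - 1) \<le> max 0 t powr (p - 1)"
           "max 0 (- t) powr (p - 1) \<le> max 0 (- s) powr (p - 1)"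
    using assms by (auto intro!: powr_mono2)
  have "max 0 s powr (p - 1) < max 0 t powr (p - 1) \<or>
        max 0 (- t) powr (p - 1) < max 0 (- s) powr (p - 1)"
  proof (cases "t > 0")
    case True
    then show ?thesis using assms by (intro disjI1 powr_less_mono2) auto
  next
    case False
    then show ?thesis using assms by (intro disjI2 powr_less_mono2) auto
  qed
  then show ?thesis
    using le assms(1) by (auto simp: signed_power_eq_diff_powr)
qed

lemma signed_power_mono:
  assumes "p > 1" and "s \<le> t"
  shows "signed_power p s \<le> signed_power p t"
  using signed_power_strict_mono[of p s t] assms by (cases "s = t") auto

lemma continuous_on_signed_power [continuous_intros]:
  fixes f :: "'a::topological_space \<Rightarrow> real"
  assumes "p > 1" and "continuous_on S f"
  shows "continuous_on S (\<lambda>x. signed_power p (f x))"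
  unfolding signed_power_eq_diff_powr[OF assms(1)]
  using assms by (intro continuous_intros continuous_on_powr') auto

section \<open>The equation at one vertex\<close>

lemma hypergraph_finite: "hypergraph V m e w \<Longrightarrow> finite V"
  by (simp add: hypergraph_def)

lemma hypergraph_weights: "hypergraph V m e w \<Longrightarrow> \<forall>k\<in>{1..m}. 0 < w k"
  by (simp add: hypergraph_def)

lemma hypergraph_edge:
  "hypergraph V m e w \<Longrightarrow> k \<in> {1..m} \<Longrightarrow> finite (e k) \<and> e k \<noteq> {} \<and> e k \<subseteq> V"
  unfolding hypergraph_def by (metis finite_subset)

text \<open>The operator with the number \<open>c k\<close> in place of the sum of the maximum and the minimum over
  \<open>e k\<close>, and with \<open>t\<close> in place of the value at \<open>x\<close>. Separating the two is what allows the
  equation at \<open>x\<close> to be solved for \<open>t\<close> while the edge data stay fixed.\<close>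

definition vertex_balance ::
  "real \<Rightarrow> nat \<Rightarrow> (nat \<Rightarrow> (real ^ 'd) set) \<Rightarrow> (nat \<Rightarrow> real) \<Rightarrow> real ^ 'd \<Rightarrow> (nat \<Rightarrow> real) \<Rightarrow> real \<Rightarrow> real" where
  "vertex_balance p m e w x c t =
     (\<Sum>k = 1..m. w k * indicator (e k) x * signed_power p (c k - 2 * t))"

definition edge_range_sum :: "(nat \<Rightarrow> (real ^ 'd) set) \<Rightarrow> (real ^ 'd \<Rightarrow> real) \<Rightarrow> nat \<Rightarrow> real" where
  "edge_range_sum e u k = Max (u ` e k) + Min (u ` e k)"

lemma hypergraph_operator_eq_vertex_balance:
  "hypergraph_operator p m e w u x = vertex_balance p m e w x (edge_range_sum e u) (u x)"
  by (simp add: hypergraph_operator_def vertex_balance_def edge_range_sum_def)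

lemma vertex_balance_term_mono:
  assumes "p > 1" and "\<forall>k\<in>{1..m}. 0 < w k" and "k \<in> {1..m}"
    and "x \<in> e k \<Longrightarrow> c k - 2 * s \<le> d k - 2 * t"
  shows "w k * indicator (e k) x * signed_power p (c k - 2 * s)
       \<le> w k * indicator (e k) x * signed_power p (d k - 2 * t)"
proof (cases "x \<in> e k")
  case True
  then show ?thesis
    using assms(2,3) signed_power_mono[OF assms(1) assms(4)[OF True]]
    by (simp add: mult_left_mono)
qed simp

lemma vertex_balance_mono:
  assumes "p > 1" and "\<forall>k\<in>{1..m}. 0 < w k"
    and "\<And>k. k \<in> {1..m} \<Longrightarrow> x \<in> e k \<Longrightarrow> c k - 2 * s \<le> d k - 2 * t"
  shows "vertex_balance p m e w x c s \<le> vertex_balance p m e w x d t"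
  unfolding vertex_balance_def
  by (intro sum_mono vertex_balance_term_mono[OF assms(1,2)] assms(3))

text \<open>
  Rigidity: the weights are positive and \<open>\<phi>\<close> is strictly increasing, so if every argument goes up
  weakly while the sum does not go up, no argument changes. All strictness used below comes from here.
\<close>

lemma vertex_balance_rigid:
  assumes "p > 1" and w: "\<forall>k\<in>{1..m}. 0 < w k"
    and k: "k \<in> {1..m}" "x \<in> e k"
    and le: "\<And>k. k \<in> {1..m} \<Longrightarrow> x \<in> e k \<Longrightarrow> c k - 2 * s \<le> d k - 2 * t"
    and ge: "vertex_balance p m e w x d t \<le> vertex_balance p m e w x c s"
  shows "c k - 2 * s = d k - 2 * t"
proof (rule ccontr)
  assume ne: "c k - 2 * s \<noteq> d k - 2 * t"
  have "vertex_balance p m e w x c s < vertex_balance p m e w x d t"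
    unfolding vertex_balance_def
  proof (rule sum_strict_mono_ex1)
    show "\<forall>i\<in>{1..m}. w i * indicator (e i) x * signed_power p (c i - 2 * s)
        \<le> w i * indicator (e i) x * signed_power p (d i - 2 * t)"
      by (intro ballI vertex_balance_term_mono[OF assms(1) w] le)
    have "signed_power p (c k - 2 * s) < signed_power p (d k - 2 * t)"
      using le[OF k] ne by (intro signed_power_strict_mono[OF assms(1)]) simp
    then show "\<exists>i\<in>{1..m}. w i * indicator (e i) x * signed_power p (c i - 2 * s)
        < w i * indicator (e i) x * signed_power p (d i - 2 * t)"
      using w k by (intro bexI[of _ k]) auto
  qed simp
  with ge show False by simp
qed

lemma vertex_balance_0:
  assumes "\<And>k. k \<in> {1..m} \<Longrightarrow> x \<in> e k \<Longrightarrow> c k = 2 * t"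
  shows "vertex_balance p m e w x c t = 0"
  unfolding vertex_balance_def by (rule sum.neutral) (auto simp: assms indicator_def)

text \<open>At \<open>t = a\<close> all arguments \<open>c k - 2 t\<close> are nonnegative and at \<open>t = b\<close> all are nonpositive, so the
  balance changes sign on \<open>{a..b}\<close>.\<close>

lemma vertex_balance_root:
  assumes "p > 1" and w: "\<forall>k\<in>{1..m}. 0 < w k" and "a \<le> b"
    and c: "\<And>k. k \<in> {1..m} \<Longrightarrow> x \<in> e k \<Longrightarrow> 2 * a \<le> c k \<and> c k \<le> 2 * b"
  shows "\<exists>t\<in>{a..b}. vertex_balance p m e w x c t = 0"
proof -
  have zero: "vertex_balance p m e w x (\<lambda>k. 2 * t) t = 0" for t
    by (rule vertex_balance_0) simp
  have "vertex_balance p m e w x c b \<le> 0"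
    using vertex_balance_mono[OF assms(1) w, of x e c b "\<lambda>k. 2 * b" b] c zero[of b] by force
  moreover have "0 \<le> vertex_balance p m e w x c a"
    using vertex_balance_mono[OF assms(1) w, of x e "\<lambda>k. 2 * a" a c a] c zero[of a] by force
  moreover have "continuous_on {a..b} (vertex_balance p m e w x c)"
    unfolding vertex_balance_def using assms(1) by (intro continuous_intros) auto
  ultimately show ?thesis
    using IVT2'[of "vertex_balance p m e w x c" b 0 a] \<open>a \<le> b\<close> by auto
qed

text \<open>A vertex on no edge would have the balance \<open>0\<close> for every \<open>t\<close>; one edge through \<open>x\<close> suffices to
  make the root unique and hence ordered like the edge data.\<close>

lemma vertex_balance_root_mono:
  assumes "p > 1" and w: "\<forall>k\<in>{1..m}. 0 < w k"
    and edge: "\<exists>k\<in>{1..m}. x \<in> e k"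
    and le: "\<And>k. k \<in> {1..m} \<Longrightarrow> x \<in> e k \<Longrightarrow> c k \<le> d k"
    and "vertex_balance p m e w x c s = 0" and "vertex_balance p m e w x d t = 0"
  shows "s \<le> t"
proof (rule ccontr)
  assume "\<not> s \<le> t"
  from edge obtain k where k: "k \<in> {1..m}" "x \<in> e k" by blast
  have "c i - 2 * s \<le> d i - 2 * t" if "i \<in> {1..m}" "x \<in> e i" for i
    using le[OF that] \<open>\<not> s \<le> t\<close> by simp
  then have "c k - 2 * s = d k - 2 * t"
    using assms(5,6) by (intro vertex_balance_rigid[where e = e, OF assms(1) w k]) auto
  with le[OF k] \<open>\<not> s \<le> t\<close> show False by simp
qed

lemma edge_range_sum_mono:
  assumes "finite (e k)" "e k \<noteq> {}" and le: "\<And>z. z \<in> e k \<Longrightarrow> u z \<le> v z"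
  shows "edge_range_sum e u k \<le> edge_range_sum e v k"
proof -
  have "Max (u ` e k) \<le> Max (v ` e k)"
    using assms by (auto intro: order_trans[OF le] Max_ge)
  moreover have "Min (u ` e k) \<le> Min (v ` e k)"
    using assms by (auto intro: order_trans[OF _ le] Min_le)
  ultimately show ?thesis by (simp add: edge_range_sum_def)
qed

lemma edge_range_sum_const:
  assumes "e k \<noteq> {}" and "\<And>z. z \<in> e k \<Longrightarrow> u z = a"
  shows "edge_range_sum e u k = 2 * a"
proof -
  have "u ` e k = {a}" using assms by auto
  then show ?thesis by (simp add: edge_range_sum_def)
qed

lemma edge_range_sum_cong:
  assumes "\<And>z. z \<in> e k \<Longrightarrow> u z = v z"
  shows "edge_range_sum e u k = edge_range_sum e v k"
  using assms by (simp add: edge_range_sum_def cong: image_cong_simp)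

section \<open>Connectedness\<close>

lemma hypergraph_connected_edge:
  assumes "hypergraph_connected V m e" and "x \<in> V"
  shows "\<exists>k\<in>{1..m}. x \<in> e k"
proof -
  obtain l :: nat and \<kappa> :: "nat \<Rightarrow> nat" where
    "1 \<le> l" "\<forall>s\<in>{1..l}. \<kappa> s \<in> {1..m}" "x \<in> e (\<kappa> 1)"
    using assms unfolding hypergraph_connected_def by meson
  then show ?thesis by (intro bexI[of _ "\<kappa> 1"]) auto
qed

lemma hypergraph_connected_absorbing:
  assumes "hypergraph_connected V m e" and "x \<in> B" "x \<in> V"
    and absorb: "\<And>k z. k \<in> {1..m} \<Longrightarrow> z \<in> e k \<Longrightarrow> z \<in> B \<Longrightarrow> e k \<subseteq> B"
  shows "V \<subseteq> B"
proof
  fix z assume "z \<in> V"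
  with assms(1,3) obtain l :: nat and \<kappa> :: "nat \<Rightarrow> nat" where
    l: "1 \<le> l" and \<kappa>: "\<forall>s\<in>{1..l}. \<kappa> s \<in> {1..m}" and x: "x \<in> e (\<kappa> 1)" and z: "z \<in> e (\<kappa> l)"
    and meet: "\<forall>s\<in>{1..<l}. e (\<kappa> s) \<inter> e (\<kappa> (s + 1)) \<noteq> {}"
    unfolding hypergraph_connected_def by meson
  have "s \<le> l \<Longrightarrow> e (\<kappa> s) \<subseteq> B" if "1 \<le> s" for s
    using that
  proof (induction s rule: dec_induct)
    case base
    show ?case using absorb[of "\<kappa> 1" x] \<kappa> l x assms(2) by auto
  next
    case (step s)
    then obtain v where "v \<in> e (\<kappa> s)" "v \<in> e (\<kappa> (Suc s))" using meet by fastforce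
    then show ?case using absorb[of "\<kappa> (Suc s)" v] \<kappa> step by auto
  qed
  with l z show "z \<in> B" by blast
qed

section \<open>The comparison principle\<close>

text \<open>
  The operator hypothesis holds at a point where the difference of a subsolution \<open>u\<close> and a
  supersolution \<open>v\<close> is largest. Raising \<open>v\<close> by \<open>M\<close> bounds the maximum and the minimum of \<open>u\<close> on each
  edge, and rigidity turns the bound on their sum into an equality, so both bounds are equalities.
  A point that realizes the maximum of \<open>u\<close> is then itself a contact point, since \<open>v\<close> there is
  at most the maximum of \<open>v\<close>.
\<close>

lemma contact_on_edge:
  assumes "p > 1" and H: "hypergraph V m e w"
    and M: "\<And>z. z \<in> V \<Longrightarrow> u z \<le> v z + M" and x: "u x = v x + M"
    and op: "hypergraph_operator p m e w v x \<le> hypergraph_operator p m e w u x"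
    and k: "k \<in> {1..m}" "x \<in> e k"
  shows "Max (u ` e k) = Max (v ` e k) + M" and "Min (u ` e k) = Min (v ` e k) + M"
    and "\<exists>z\<in>e k. u z = Max (u ` e k) \<and> u z = v z + M"
proof -
  note w = hypergraph_weights[OF H] and e = hypergraph_edge[OF H]
  have Max_bound: "Max (u ` e i) \<le> Max (v ` e i) + M" if i: "i \<in> {1..m}" for i
  proof -
    have "u z \<le> Max (v ` e i) + M" if "z \<in> e i" for z
    proof -
      have "v z \<le> Max (v ` e i)" using that e[OF i] by (intro Max_ge) auto
      moreover have "u z \<le> v z + M" using that e[OF i] by (intro M) auto
      ultimately show ?thesis by simp
    qed
    then show ?thesis using e[OF i] by auto
  qed
  have Min_bound: "Min (u ` e i) \<le> Min (v ` e i) + M" if i: "i \<in> {1..m}" for i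
  proof -
    have "Min (v ` e i) \<in> v ` e i" using e[OF i] by (intro Min_in) auto
    then obtain z where z: "z \<in> e i" "Min (v ` e i) = v z" by auto
    then have "Min (u ` e i) \<le> u z" using e[OF i] by auto
    also have "u z \<le> v z + M" using z(1) e[OF i] by (intro M) auto
    finally show ?thesis using z(2) by simp
  qed
  have "edge_range_sum e u k - 2 * u x = edge_range_sum e v k - 2 * v x"
  proof (rule vertex_balance_rigid[where e = e, OF assms(1) w k])
    show "edge_range_sum e u i - 2 * u x \<le> edge_range_sum e v i - 2 * v x"
      if "i \<in> {1..m}" for i
      using Max_bound[OF that] Min_bound[OF that] x by (simp add: edge_range_sum_def)
  qed (use op in \<open>simp add: hypergraph_operator_eq_vertex_balance\<close>)
  then show Max_eq: "Max (u ` e k) = Max (v ` e k) + M"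
    and "Min (u ` e k) = Min (v ` e k) + M"
    using Max_bound[OF k(1)] Min_bound[OF k(1)] x by (simp_all add: edge_range_sum_def)
  have "Max (u ` e k) \<in> u ` e k" using e[OF k(1)] by (intro Max_in) auto
  then obtain z where z: "z \<in> e k" "u z = Max (u ` e k)" by auto
  moreover have "v z \<le> Max (v ` e k)" using z(1) e[OF k(1)] by (intro Max_ge) auto
  moreover have "u z \<le> v z + M" using z(1) e[OF k(1)] by (intro M) auto
  ultimately show "\<exists>z\<in>e k. u z = Max (u ` e k) \<and> u z = v z + M"
    using Max_eq by (intro bexI[of _ z]) auto
qed

text \<open>
  The strong form of the maximum principle: a subsolution that is largest at \<open>x\<close> on every edge
  through \<open>x\<close> is constant on these edges, because each argument is then \<open>Min - u x \<le> 0\<close>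
  while the weighted sum of the terms is nonnegative.
\<close>

lemma subsolution_const_on_edge:
  assumes "p > 1" and H: "hypergraph V m e w"
    and op: "0 \<le> hypergraph_operator p m e w u x"
    and Max: "\<And>k. k \<in> {1..m} \<Longrightarrow> x \<in> e k \<Longrightarrow> Max (u ` e k) = u x"
    and k: "k \<in> {1..m}" "x \<in> e k"
  shows "Min (u ` e k) = u x"
proof -
  note w = hypergraph_weights[OF H] and e = hypergraph_edge[OF H]
  have "edge_range_sum e u k - 2 * u x = 2 * u x - 2 * u x"
  proof (rule vertex_balance_rigid[where e = e, OF assms(1) w k])
    show "edge_range_sum e u i - 2 * u x \<le> 2 * u x - 2 * u x"
      if i: "i \<in> {1..m}" "x \<in> e i" for i
    proof -
      have "Min (u ` e i) \<le> u x" using e i by auto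
      with Max[OF i] show ?thesis by (simp add: edge_range_sum_def)
    qed
    have "vertex_balance p m e w x (\<lambda>k. 2 * u x) (u x) = 0"
      by (rule vertex_balance_0) simp
    then show "vertex_balance p m e w x (\<lambda>k. 2 * u x) (u x)
        \<le> vertex_balance p m e w x (edge_range_sum e u) (u x)"
      using op by (simp add: hypergraph_operator_eq_vertex_balance)
  qed
  then show ?thesis using Max[OF k] by (simp add: edge_range_sum_def)
qed

lemma hypergraph_comparison:
  fixes V L :: "(real ^ 'd) set"
  assumes p: "p > 1" and H: "hypergraph V m e w" and conn: "hypergraph_connected V m e"
    and L: "L \<subseteq> V" "L \<noteq> {}"
    and sub: "\<And>x. x \<in> V - L \<Longrightarrow> 0 \<le> hypergraph_operator p m e w u x"
    and super: "\<And>x. x \<in> V - L \<Longrightarrow> hypergraph_operator p m e w v x \<le> 0"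
    and le: "\<And>x. x \<in> L \<Longrightarrow> u x \<le> v x"
    and "x \<in> V"
  shows "u x \<le> v x"
proof (rule ccontr)
  assume "\<not> u x \<le> v x"
  note fin = hypergraph_finite[OF H] and w = hypergraph_weights[OF H] and e = hypergraph_edge[OF H]
  define M where "M = Max ((\<lambda>z. u z - v z) ` V)"
  define A where "A = {z \<in> V. u z = v z + M}"
  have M: "u z \<le> v z + M" if "z \<in> V" for z
  proof -
    have "u z - v z \<le> M" unfolding M_def using fin that by (intro Max_ge) auto
    then show ?thesis by simp
  qed
  have "M > 0" using M[OF \<open>x \<in> V\<close>] \<open>\<not> u x \<le> v x\<close> by simp
  then have off_L: "z \<in> V - L" if "z \<in> A" for z
    using that le[of z] by (auto simp: A_def)
  have "M \<in> (\<lambda>z. u z - v z) ` V"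
    unfolding M_def using fin \<open>x \<in> V\<close> by (intro Max_in) auto
  then have "A \<noteq> {}" by (auto simp: A_def)
  have "finite A" using fin by (simp add: A_def)
  \<comment> \<open>The contact set \<open>A\<close> need not contain the edges that it meets; its part \<open>B\<close> where \<open>u\<close> is
    largest does.\<close>
  define N where "N = Max (u ` A)"
  define B where "B = {z \<in> A. u z = N}"
  have "N \<in> u ` A" unfolding N_def using \<open>finite A\<close> \<open>A \<noteq> {}\<close> by (intro Max_in) auto
  then obtain b where b: "b \<in> B" by (auto simp: B_def)
  have "e k \<subseteq> B" if k: "k \<in> {1..m}" "z \<in> e k" and z: "z \<in> B" for k z
  proof -
    have zA: "z \<in> A" "u z = N" using z by (auto simp: B_def)
    have contact: "u z = v z + M" using zA by (simp add: A_def)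
    have op: "hypergraph_operator p m e w v z \<le> hypergraph_operator p m e w u z"
      using sub super off_L[OF zA(1)] by (meson order_trans)
    note edge = contact_on_edge[OF p H M contact op]
    have top: "Max (u ` e i) = u z" if i: "i \<in> {1..m}" "z \<in> e i" for i
    proof (rule antisym)
      obtain a where a: "a \<in> e i" "u a = Max (u ` e i)" "u a = v a + M"
        using edge(3)[OF _ i] by blast
      then have "a \<in> A" using e[OF i(1)] by (auto simp: A_def)
      then have "u a \<le> N" unfolding N_def using \<open>finite A\<close> by (intro Max_ge) auto
      then show "Max (u ` e i) \<le> u z" using a(2) zA(2) by simp
      show "u z \<le> Max (u ` e i)" using i e by auto
    qed
    have bottom: "Min (u ` e k) = u z"
      using sub off_L[OF zA(1)] by (intro subsolution_const_on_edge[where e = e, OF p H _ top k])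
        auto
    show "e k \<subseteq> B"
    proof
      fix a assume a: "a \<in> e k"
      have "Min (u ` e k) \<le> u a" "u a \<le> Max (u ` e k)"
           "Min (v ` e k) \<le> v a" "v a \<le> Max (v ` e k)"
        using a e[OF k(1)] by auto
      then have "u a = u z" "v a = v z"
        using top[OF k] bottom edge(1)[OF _ k] edge(2)[OF _ k] contact by auto
      then show "a \<in> B" using a e[OF k(1)] zA contact by (auto simp: A_def B_def)
    qed
  qed
  then have "V \<subseteq> B"
    using b by (intro hypergraph_connected_absorbing[OF conn b]) (auto simp: A_def B_def)
  with L off_L show False by (auto simp: B_def)
qed

lemma hypergraph_operator_const:
  assumes "hypergraph V m e w"
  shows "hypergraph_operator p m e w (\<lambda>_. a) x = 0"
  unfolding hypergraph_operator_eq_vertex_balance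
  using assms by (intro vertex_balance_0 edge_range_sum_const) (auto simp: hypergraph_def)

section \<open>Existence\<close>

text \<open>The Knaster--Tarski theorem in a box of real functions, which is a complete lattice although
  the reals are not.\<close>

lemma monotone_fixed_point_in_box:
  fixes T :: "('a \<Rightarrow> real) \<Rightarrow> 'a \<Rightarrow> real"
  assumes ab: "a \<le> b"
    and box: "\<And>u x. (\<And>z. u z \<in> {a..b}) \<Longrightarrow> T u x \<in> {a..b}"
    and mono: "\<And>u v x. (\<And>z. u z \<in> {a..b}) \<Longrightarrow> (\<And>z. v z \<in> {a..b}) \<Longrightarrow>
                 (\<And>z. u z \<le> v z) \<Longrightarrow> T u x \<le> T v x"
  shows "\<exists>u. (\<forall>x. u x \<in> {a..b}) \<and> T u = u"
proof -
  define S where "S = {u. (\<forall>x. u x \<in> {a..b}) \<and> (\<forall>x. u x \<le> T u x)}"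
  define U where "U x = (SUP u\<in>S. u x)" for x
  have "(\<lambda>_. a) \<in> S" using box[of "\<lambda>_. a"] ab by (auto simp: S_def)
  then have "S \<noteq> {}" by blast
  have bdd: "bdd_above ((\<lambda>u. u x) ` S)" for x by (auto simp: S_def intro!: bdd_aboveI[of _ b])
  have upper: "u x \<le> U x" if "u \<in> S" for u x
    unfolding U_def using that bdd by (rule cSUP_upper)
  have U_box: "U x \<in> {a..b}" for x
  proof -
    have "U x \<le> b" unfolding U_def using \<open>S \<noteq> {}\<close> by (rule cSUP_least) (auto simp: S_def)
    then show ?thesis using upper[OF \<open>(\<lambda>_. a) \<in> S\<close>, of x] by simp
  qed
  have post: "U x \<le> T U x" for x
    unfolding U_def[of x] using \<open>S \<noteq> {}\<close>
  proof (rule cSUP_least)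
    fix u assume u: "u \<in> S"
    then have "u x \<le> T u x" by (simp add: S_def)
    also have "\<dots> \<le> T U x" using u upper[OF u] U_box by (intro mono) (auto simp: S_def)
    finally show "u x \<le> T U x" .
  qed
  \<comment> \<open>Monotonicity applied to \<open>U \<le> T U\<close> gives \<open>T U \<le> T (T U)\<close>.\<close>
  have "T U \<in> S" using box[OF U_box] mono[OF U_box box[OF U_box] post] by (simp add: S_def)
  then have "T U x \<le> U x" for x by (rule upper)
  with post have "T U = U" by (intro ext antisym) auto
  with U_box show ?thesis by blast
qed

lemma hypergraph_solution_exists:
  fixes V L :: "(real ^ 'd) set"
  assumes p: "p > 1" and H: "hypergraph V m e w" and conn: "hypergraph_connected V m e"
    and L: "L \<subseteq> V" "L \<noteq> {}"
  shows "\<exists>u. is_solution p V m e w L y u"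
proof -
  note fin = hypergraph_finite[OF H] and w = hypergraph_weights[OF H] and e = hypergraph_edge[OF H]
  have finL: "finite L" using fin L(1) by (rule finite_subset[rotated])
  define a where "a = Min (y ` L)"
  define b where "b = Max (y ` L)"
  have y: "a \<le> y x \<and> y x \<le> b" if "x \<in> L" for x
    using that finL by (simp add: a_def b_def)
  then have ab: "a \<le> b" using L(2) by force
  define root where "root u x t \<longleftrightarrow> t \<in> {a..b} \<and> vertex_balance p m e w x (edge_range_sum e u) t = 0"
    for u x t
  \<comment> \<open>The default value \<open>a\<close> off \<open>V\<close> keeps \<open>T u\<close> inside the box.\<close>
  define T where "T u x = (if x \<in> L then y x else if x \<in> V then SOME t. root u x t else a)"
    for u x
  have root_ex: "\<exists>t. root u x t" if u: "\<And>z. u z \<in> {a..b}" for u x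
  proof -
    have "2 * a \<le> edge_range_sum e u k \<and> edge_range_sum e u k \<le> 2 * b" if k: "k \<in> {1..m}" for k
      using edge_range_sum_mono[of e k "\<lambda>_. a" u] edge_range_sum_mono[of e k u "\<lambda>_. b"]
        edge_range_sum_const[of e k "\<lambda>_. a" a] edge_range_sum_const[of e k "\<lambda>_. b" b] e[OF k] u
      by auto
    then show ?thesis
      using vertex_balance_root[where x = x and e = e and c = "edge_range_sum e u", OF p w ab]
      by (auto simp: root_def)
  qed
  have T_root: "root u x (T u x)" if "\<And>z. u z \<in> {a..b}" "x \<in> V - L" for u x
    using someI_ex[OF root_ex[where u = u and x = x, OF that(1)]] that(2) by (simp add: T_def)
  have "\<exists>u. (\<forall>x. u x \<in> {a..b}) \<and> T u = u"
  proof (rule monotone_fixed_point_in_box[OF ab])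
    fix u :: "real ^ 'd \<Rightarrow> real" and x
    assume u: "\<And>z. u z \<in> {a..b}"
    show "T u x \<in> {a..b}"
    proof (cases "x \<in> V - L")
      case True
      then show ?thesis using T_root[OF u True] by (simp add: root_def)
    next
      case False
      then show ?thesis using y ab by (auto simp: T_def)
    qed
  next
    fix u v :: "real ^ 'd \<Rightarrow> real" and x
    assume u: "\<And>z. u z \<in> {a..b}" and v: "\<And>z. v z \<in> {a..b}" and uv: "\<And>z. u z \<le> v z"
    show "T u x \<le> T v x"
    proof (cases "x \<in> V - L")
      case True
      show ?thesis
      proof (rule vertex_balance_root_mono[OF p w])
        show "\<exists>k\<in>{1..m}. x \<in> e k"
          using hypergraph_connected_edge[OF conn] True by blast
        show "vertex_balance p m e w x (edge_range_sum e u) (T u x) = 0"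
          using T_root[OF u True] by (simp add: root_def)
        show "vertex_balance p m e w x (edge_range_sum e v) (T v x) = 0"
          using T_root[OF v True] by (simp add: root_def)
        show "edge_range_sum e u k \<le> edge_range_sum e v k" if "k \<in> {1..m}" for k
          using e[OF that] uv by (intro edge_range_sum_mono) auto
      qed
    next
      case False
      then show ?thesis by (auto simp: T_def)
    qed
  qed
  then obtain u where u: "\<And>x. u x \<in> {a..b}" and fixed: "T u = u" by blast
  have "is_solution p V m e w L y (restrict u V)"
    unfolding is_solution_def
  proof (intro conjI ballI)
    fix x assume x: "x \<in> L"
    then show "restrict u V x = y x" using L(1) fun_cong[OF fixed, of x] by (auto simp: T_def)
  next
    fix x assume x: "x \<in> V - L"
    have "vertex_balance p m e w x (edge_range_sum e (restrict u V)) (u x)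
        = vertex_balance p m e w x (edge_range_sum e u) (u x)"
      unfolding vertex_balance_def
    proof (rule sum.cong)
      fix k assume k: "k \<in> {1..m}"
      have "edge_range_sum e (restrict u V) k = edge_range_sum e u k"
        using e[OF k] by (intro edge_range_sum_cong) auto
      then show "w k * indicator (e k) x * signed_power p (edge_range_sum e (restrict u V) k - 2 * u x)
          = w k * indicator (e k) x * signed_power p (edge_range_sum e u k - 2 * u x)"
        by simp
    qed simp
    also have "\<dots> = 0" using T_root[where u = u and x = x, OF u x] by (simp add: fixed root_def)
    finally show "hypergraph_operator p m e w (restrict u V) x = 0"
      using x by (simp add: hypergraph_operator_eq_vertex_balance)
  qed auto
  then show ?thesis by blast
qed

section \<open>Well-posedness\<close>

theorem theorem2p7:
  fixes p :: real
    and V L :: "(real ^ 'd) set"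
    and m :: nat
    and e :: "nat \<Rightarrow> (real ^ 'd) set"
    and w :: "nat \<Rightarrow> real"
    and y :: "real ^ 'd \<Rightarrow> real"
  assumes "p > 1"
    and "hypergraph V m e w"
    and "hypergraph_connected V m e"
    and "L \<subseteq> V"
    and "L \<noteq> {}"
  shows "(\<exists>!u. is_solution p V m e w L y u) \<and>
         (\<forall>u. is_solution p V m e w L y u \<longrightarrow>
            (\<forall>x\<in>V. Min (y ` L) \<le> u x \<and> u x \<le> Max (y ` L)))"
proof (intro conjI allI impI ballI)
  note data = assms(1-5)
  have le: "u x \<le> v x"
    if "is_solution p V m e w L y u" "is_solution p V m e w L y v" "x \<in> V" for u v x
    using that by (intro hypergraph_comparison[where u = u and v = v and x = x, OF data])
      (auto simp: is_solution_def)
  show "\<exists>!u. is_solution p V m e w L y u"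
  proof (rule ex_ex1I[OF hypergraph_solution_exists[OF data]])
    fix u v assume u: "is_solution p V m e w L y u" and v: "is_solution p V m e w L y v"
    show "u = v"
    proof (rule PiE_ext)
      show "u \<in> V \<rightarrow>\<^sub>E (UNIV :: real set)" "v \<in> V \<rightarrow>\<^sub>E (UNIV :: real set)"
        using u v by (auto simp: is_solution_def)
      show "u x = v x" if "x \<in> V" for x
        using le[OF u v that] le[OF v u that] by simp
    qed
  qed
next
  note data = assms(1-5)
  fix u x assume u: "is_solution p V m e w L y u" and x: "x \<in> V"
  have "finite L" using assms(2,4) by (auto simp: hypergraph_def intro: finite_subset)
  then have y: "Min (y ` L) \<le> u z \<and> u z \<le> Max (y ` L)" if "z \<in> L" for z
    using u that by (simp add: is_solution_def)
  note const = hypergraph_operator_const[OF assms(2), of p]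
  show "Min (y ` L) \<le> u x"
    using u y x by (intro hypergraph_comparison
        [where u = "\<lambda>_. Min (y ` L)" and v = u and x = x, OF data])
      (auto simp: is_solution_def const)
  show "u x \<le> Max (y ` L)"
    using u y x by (intro hypergraph_comparison
        [where u = u and v = "\<lambda>_. Max (y ` L)" and x = x, OF data])
      (auto simp: is_solution_def const)
qed

end
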